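(* Let $n\ge1$, let $G$ be an abelian subgroup of $GL(n,\mathbb{C})$ and let $u\in\mathbb{C}^n$. Then the closure $\overline{G(u)}$ is a (complex) vector subspace of $\mathbb{C}^n$ if and only if $G(u)$ is regular with order $2r(u)$.
   Context: $G$ acts on $\mathbb{C}^n$ by $(A,v)\mapsto Av$; $G(u)=\{Au:A\in G\}$ is the orbit of $u$, $E(u)$ is the complex linear span of $G(u)$, and $r(u)=\dim_{\mathbb{C}}E(u)$. An orbit $\gamma$ is regular with order $m$ if for every $v\in\gamma$ there is an open set $O$ of $\mathbb{C}^n$ containing $v$ such that $\overline{\gamma}\cap O$ is a manifold of dimension $m$ over $\mathbb{R}$. *)

theory Defs
  imports "HOL-Analysis.Analysis" "HOL-Algebra.Group"
begin

definition general_linear_group :: "(complex ^ 'n ^ 'n) monoid"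
  where "general_linear_group =
    \<lparr>carrier = {A. invertible A}, monoid.mult = (**), one = mat 1\<rparr>"

lemma group_general_linear_group: "group (general_linear_group :: (complex ^ 'n ^ 'n) monoid)"
proof (rule groupI)
  fix A :: "complex ^ 'n ^ 'n"
  assume "A \<in> carrier general_linear_group"
  then show "\<exists>B\<in>carrier general_linear_group.
      B \<otimes>\<^bsub>general_linear_group\<^esub> A = \<one>\<^bsub>general_linear_group\<^esub>"
    by (auto simp: general_linear_group_def invertible_def)
qed (auto simp: general_linear_group_def invertible_mult matrix_mul_assoc intro: exI[of _ "mat 1"] simp: invertible_def[of "mat 1"])

definition linear_orbit :: "(complex ^ 'n ^ 'n) set \<Rightarrow> complex ^ 'n \<Rightarrow> (complex ^ 'n) set"
  where "linear_orbit G u = {A *v u |A. A \<in> G}"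

text \<open>Here \<open>vec.span\<close> and \<open>vec.dim\<close> refer to scalar multiplication
  \<open>(*s)\<close> by complex numbers, whereas the unqualified \<open>span\<close> and \<open>dim\<close> would be over the reals.\<close>

definition orbit_span :: "(complex ^ 'n ^ 'n) set \<Rightarrow> complex ^ 'n \<Rightarrow> (complex ^ 'n) set"
  where "orbit_span G u = vec.span (linear_orbit G u)"

definition orbit_rank :: "(complex ^ 'n ^ 'n) set \<Rightarrow> complex ^ 'n \<Rightarrow> nat"
  where "orbit_rank G u = vec.dim (orbit_span G u)"

definition topological_manifold :: "nat \<Rightarrow> 'a topology \<Rightarrow> bool"
  where "topological_manifold m X \<longleftrightarrow>
    Hausdorff_space X \<and> second_countable X \<and>
    (\<forall>x\<in>topspace X. \<exists>U V. openin X U \<and> x \<in> U \<and> openin (Euclidean_space m) V \<and>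
       subtopology X U homeomorphic_space subtopology (Euclidean_space m) V)"

definition regular_with_order :: "(complex ^ 'n) set \<Rightarrow> nat \<Rightarrow> bool"
  where "regular_with_order \<gamma> m \<longleftrightarrow>
    (\<forall>v\<in>\<gamma>. \<exists>W. open W \<and> v \<in> W \<and> topological_manifold m (top_of_set (closure \<gamma> \<inter> W)))"

end

theory Submission
  imports Defs "HOL-Homology.Invariance_of_Domain"
begin

text \<open>
  Let \<open>E\<close> be the complex span of the orbit of \<open>u\<close>, and \<open>K \<subseteq> E\<close> the closure of the orbit. Every complex
  subspace that contains the orbit contains \<open>E\<close>, so \<open>K\<close> is a complex subspace iff \<open>K = E\<close>
  (\<open>closure_orbit_subspace_iff\<close>). As a real vector space \<open>E\<close> has dimension \<open>2r\<close> (\<open>dim_eq_twice_vec_dim\<close>), so if \<open>K = E\<close>, then the closure is globally a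
  \<open>2r\<close>-manifold.

  For the converse, a chart at \<open>u\<close> embeds an open subset of \<open>2r\<close>-dimensional real space into \<open>E\<close>,
  which has the same dimension, so by invariance of
  domain \<open>u\<close> is interior to \<open>K\<close> relative to \<open>E\<close> (\<open>full_dimensional_submanifold_open\<close>). It remains
  to see that an orbit closure with interior at \<open>u\<close> is everything (\<open>closure_orbit_eq_span\<close>).

  Because \<open>G\<close> is abelian, every \<open>w \<in> E\<close> has the form \<open>T u\<close> with a matrix \<open>T\<close> that commutes with
  \<open>G\<close> (\<open>orbit_span_eq_commutant_orbit\<close>). A matrix \<open>S\<close> that commutes with \<open>G\<close> and moves \<open>u\<close> into \<open>K\<close>
  maps all of \<open>K\<close> into \<open>K\<close>; if \<open>S\<close> is also invertible, it carries the neighbourhood of \<open>u\<close> in \<open>K\<close>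
  to a neighbourhood of \<open>S u\<close> in \<open>K\<close> (\<open>closure_orbit_neighbourhood\<close>). For invertible such \<open>S\<close>,
  the closed condition \<open>S u \<in> K\<close> is therefore also an open one. Join \<open>1\<close> to \<open>T\<close> by the complex
  line \<open>1 + c (T - 1)\<close>. The determinant is a nonzero polynomial in \<open>c\<close>, so the invertible matrices
  on this line are parametrized by the complement of a finite subset of the plane, which is
  connected and dense. Connectedness puts \<open>(1 + c (T - 1)) u\<close> in \<open>K\<close> for all these \<open>c\<close>,
  and density then for every \<open>c\<close>, in particular for \<open>c = 1\<close>, where it is \<open>w\<close>.
\<close>

section \<open>Complex subspaces as real subspaces\<close>

lemma scaleR_eq_complex_smult: "r *\<^sub>R x = complex_of_real r *s (x :: complex ^ 'n)"
  unfolding vec_eq_iff vector_scaleR_component vector_smult_component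
  by (simp add: scaleR_conv_of_real)

lemma subspace_if_vec_subspace:
  fixes S :: "(complex ^ 'n) set"
  assumes "vec.subspace S"
  shows "subspace S"
  using assms by (auto simp: subspace_def vec.subspace_def scaleR_eq_complex_smult)

text \<open>By induction on \<open>B\<close>: a new basis vector \<open>b\<close> adds the two real directions \<open>b\<close> and \<open>\<i> b\<close>.
  They are independent modulo the complex subspace \<open>S\<close> spanned so far, since \<open>b - k \<i> b \<in> S\<close>
  with \<open>k\<close> real would give \<open>b \<in> S\<close> on division by \<open>1 - k \<i> \<noteq> 0\<close>.\<close>

lemma dim_vec_span_independent:
  fixes B :: "(complex ^ 'n) set"
  assumes "finite B" "vec.independent B"
  shows "dim (vec.span B) = 2 * card B"
  using assms
proof (induction B rule: finite_induct)
  case empty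
  then show ?case by simp
next
  case (insert b B)
  let ?S = "vec.span B"
  have ind: "vec.independent B" and b: "b \<notin> ?S"
    using insert.prems insert.hyps by (auto simp: vec.independent_insert)
  have S: "span ?S = ?S"
    by (simp add: span_eq_iff subspace_if_vec_subspace)
  have "\<i> *s b \<notin> ?S"
  proof
    assume "\<i> *s b \<in> ?S"
    from vec.span_scale[OF this, of "-\<i>"] show False using b by simp
  qed
  moreover have "b \<notin> span (insert (\<i> *s b) ?S)"
  proof
    assume "b \<in> span (insert (\<i> *s b) ?S)"
    then obtain k where "b - k *\<^sub>R (\<i> *s b) \<in> ?S"
      unfolding span_breakdown_eq S by blast
    moreover define c where "c = 1 - of_real k * \<i>"
    ultimately have "c *s b \<in> ?S"
      by (simp add: scaleR_eq_complex_smult vector_sub_rdistrib)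
    then have "inverse c *s (c *s b) \<in> ?S"
      by (rule vec.span_scale)
    moreover have "c \<noteq> 0"
      by (simp add: c_def complex_eq_iff)
    ultimately show False
      using b by (simp add: vector_smult_assoc)
  qed
  ultimately have "dim (insert b (insert (\<i> *s b) ?S)) = dim ?S + 2"
    by (simp add: dim_insert S)
  also have "dim (insert b (insert (\<i> *s b) ?S)) = dim (vec.span (insert b B))"
  proof -
    have "span (insert b (insert (\<i> *s b) ?S)) = vec.span (insert b B)"
    proof
      have "insert b (insert (\<i> *s b) ?S) \<subseteq> vec.span (insert b B)"
        using vec.span_mono[of B "insert b B"]
        by (auto intro: vec.span_base vec.span_scale)
      then show "span (insert b (insert (\<i> *s b) ?S)) \<subseteq> vec.span (insert b B)"
        by (simp add: span_minimal subspace_if_vec_subspace)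
      show "vec.span (insert b B) \<subseteq> span (insert b (insert (\<i> *s b) ?S))"
      proof
        fix x assume "x \<in> vec.span (insert b B)"
        then obtain k where k: "x - k *s b \<in> ?S"
          unfolding vec.span_breakdown_eq by blast
        have "x - Re k *\<^sub>R b - Im k *\<^sub>R (\<i> *s b) = x - k *s b"
          by (simp add: vec_eq_iff complex_eq_iff algebra_simps)
        then have "x - Re k *\<^sub>R b - Im k *\<^sub>R (\<i> *s b) \<in> span ?S"
          unfolding S using k by (rule ssubst)
        then show "x \<in> span (insert b (insert (\<i> *s b) ?S))"
          unfolding span_breakdown_eq by blast
      qed
    qed
    then show ?thesis by (metis dim_span)
  qed
  finally show ?case
    using insert ind by simp
qed

lemma dim_eq_twice_vec_dim:
  fixes S :: "(complex ^ 'n) set"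
  assumes "vec.subspace S"
  shows "dim S = 2 * vec.dim S"
proof -
  obtain B where B: "B \<subseteq> S" "vec.independent B" "S \<subseteq> vec.span B" "card B = vec.dim S"
    by (rule vec.basis_exists)
  then have "vec.span B = S"
    using assms by (simp add: vec.span_minimal subset_antisym)
  then show ?thesis
    using dim_vec_span_independent[of B] B by (simp add: vec.finiteI_independent)
qed

section \<open>Manifolds inside a linear subspace\<close>

lemma topological_manifold_subspace:
  fixes S :: "'a::euclidean_space set"
  assumes "subspace S"
  shows "topological_manifold (dim S) (top_of_set S)"
proof -
  have "second_countable (euclidean :: 'a topology)"
    using ex_countable_basis[where 'a='a] unfolding second_countable_def
    by (metis open_openin topological_basisE topological_basis_open)
  then have "second_countable (top_of_set S)"
    by (rule second_countable_subtopology)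
  moreover have "top_of_set S homeomorphic_space Euclidean_space (dim S)"
    using assms by (rule homeomorphic_subspace_Euclidean_space_dim)
  ultimately show ?thesis
    unfolding topological_manifold_def
    by (auto simp: Hausdorff_space_subtopology subtopology_subtopology
        intro!: exI[of _ S] exI[of _ "topspace (Euclidean_space (dim S))"])
qed

text \<open>Both the chart domain in \<open>M\<close> and, after identifying Euclidean space with \<open>E\<close>, its coordinate
  image are subsets of the same space \<open>E\<close>. The coordinate image is open there, so invariance of
  domain, applied to the inverse chart as a map from \<open>E\<close> to \<open>E\<close>, makes the chart domain open too.\<close>

lemma full_dimensional_submanifold_open:
  fixes E M :: "'a::euclidean_space set"
  assumes E: "subspace E" and "M \<subseteq> E"
    and mfd: "topological_manifold (dim E) (top_of_set M)" and "x \<in> M"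
  obtains U where "openin (top_of_set E) U" "x \<in> U" "U \<subseteq> M"
proof -
  obtain U V where U: "openin (top_of_set M) U" "x \<in> U"
    and V: "openin (Euclidean_space (dim E)) V"
    and UV: "subtopology (top_of_set M) U homeomorphic_space subtopology (Euclidean_space (dim E)) V"
    using mfd \<open>x \<in> M\<close> unfolding topological_manifold_def by auto
  have "U \<subseteq> M"
    using U(1) openin_imp_subset by blast
  obtain h where h: "homeomorphic_map (Euclidean_space (dim E)) (top_of_set E) h"
    using homeomorphic_subspace_Euclidean_space_dim[OF E] homeomorphic_space_sym
      homeomorphic_space by blast
  have hV: "openin (top_of_set E) (h ` V)"
    using h V homeomorphic_map_openness_eq by blast
  have "homeomorphic_map (subtopology (Euclidean_space (dim E)) V) (subtopology (top_of_set E) (h ` V)) h"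
    using h V openin_subset[OF V] openin_subset[OF hV]
    by (intro homeomorphic_map_subtopologies) (auto dest: homeomorphic_imp_injective_map simp: inj_on_def)
  then have "subtopology (Euclidean_space (dim E)) V homeomorphic_space top_of_set (h ` V)"
    using openin_imp_subset[OF hV]
    by (metis homeomorphic_map_imp_homeomorphic_space subtopology_subtopology inf.absorb_iff2)
  with UV have "top_of_set U homeomorphic_space top_of_set (h ` V)"
    using \<open>U \<subseteq> M\<close> homeomorphic_space_trans
    by (metis subtopology_subtopology inf.absorb_iff2)
  then have "h ` V homeomorphic U"
    by (metis homeomorphic_space_iff_homeomorphic homeomorphic_sym)
  then obtain f g where "homeomorphism (h ` V) U f g"
    unfolding homeomorphic_def by blast
  then have f: "continuous_on (h ` V) f" "f ` h ` V = U" "inj_on f (h ` V)"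
    by (auto simp: homeomorphism_def intro: inj_on_inverseI[of _ g])
  have "openin (top_of_set E) (f ` h ` V)"
    using f \<open>U \<subseteq> M\<close> \<open>M \<subseteq> E\<close>
    by (intro invariance_of_domain_subspaces[OF hV E E]) auto
  with f U \<open>U \<subseteq> M\<close> that show thesis by metis
qed

section \<open>Lines of complex matrices\<close>

lemma linear_matrix_vector_mult_complex:
  "linear ((*v) (A :: complex ^ 'n ^ 'm))"
  by (intro linearI) (simp_all add: matrix_vector_right_distrib scaleR_eq_complex_smult vector_scalar_commute)

lemma continuous_on_matrix_vector_mult_complex:
  "continuous_on S ((*v) (A :: complex ^ 'n ^ 'm))"
  by (simp add: linear_matrix_vector_mult_complex linear_continuous_on linear_linear)

lemma matrix_add_scaled_mult:
  fixes A B :: "complex ^ 'n ^ 'm"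
  shows "(\<chi> i j. A $ i $ j + c * B $ i $ j) *v x = A *v x + c *s (B *v x)"
  by (simp add: vec_eq_iff matrix_vector_mult_def distrib_right sum.distrib sum_distrib_left mult.assoc)

text \<open>The determinant along the line is the value at \<open>c\<close> of a polynomial, namely the determinant of
  the matrix with linear polynomials as entries. This polynomial does not vanish at \<open>0\<close>.\<close>

lemma finite_singular_parameters:
  fixes A B :: "complex ^ 'n ^ 'n"
  assumes "det A \<noteq> 0"
  shows "finite {c. det (\<chi> i j. A $ i $ j + c * B $ i $ j) = 0}"
proof -
  define P :: "complex poly ^ 'n ^ 'n" where "P = (\<chi> i j. [:A $ i $ j, B $ i $ j:])"
  have P: "poly (det P) c = det (\<chi> i j. A $ i $ j + c * B $ i $ j)" for c
    by (simp add: det_def P_def poly_sum poly_prod of_int_poly)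
  have "poly (det P) 0 \<noteq> 0"
    using assms by (simp add: P)
  then have "det P \<noteq> 0" by auto
  then show ?thesis
    using poly_roots_finite[of "det P"] by (simp add: P)
qed

section \<open>Orbits of commuting matrices\<close>

locale commuting_matrix_monoid =
  fixes G :: "(complex ^ 'n ^ 'n) set"
  assumes one_mem: "mat 1 \<in> G"
    and mult_mem: "\<lbrakk>A \<in> G; B \<in> G\<rbrakk> \<Longrightarrow> A ** B \<in> G"
    and mult_commute: "\<lbrakk>A \<in> G; B \<in> G\<rbrakk> \<Longrightarrow> A ** B = B ** A"
begin

lemma linear_orbit_self: "u \<in> linear_orbit G u"
  unfolding linear_orbit_def using one_mem by force

lemma closure_orbit_subset_span: "closure (linear_orbit G u) \<subseteq> orbit_span G u"
  unfolding orbit_span_def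
  by (intro closure_minimal closed_subspace subspace_if_vec_subspace vec.subspace_span)
     (auto intro: vec.span_base)

definition commutant :: "(complex ^ 'n ^ 'n) set"
  where "commutant = {T. \<forall>A\<in>G. T ** A = A ** T}"

lemma commutantD:
  "\<lbrakk>T \<in> commutant; A \<in> G\<rbrakk> \<Longrightarrow> T *v (A *v x) = A *v (T *v x)"
  by (simp add: commutant_def matrix_vector_mul_assoc)

lemma commutant_add_scaled:
  assumes "S \<in> commutant" "T \<in> commutant"
  shows "(\<chi> i j. S $ i $ j + c * T $ i $ j) \<in> commutant"
  unfolding commutant_def
  by (auto simp: matrix_eq matrix_add_scaled_mult matrix_vector_right_distrib
      vector_scalar_commute commutantD[OF assms(1)] commutantD[OF assms(2)]
      simp flip: matrix_vector_mul_assoc)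

text \<open>The vectors of the form \<open>T u\<close> with \<open>T\<close> in the commutant form a complex subspace, and it
  contains the orbit because \<open>G\<close>, being commutative, lies in its own commutant.\<close>

lemma orbit_span_eq_commutant_orbit:
  assumes "w \<in> orbit_span G u"
  obtains T where "T \<in> commutant" "T *v u = w"
proof -
  have "\<exists>T\<in>commutant. T *v u = w"
    using assms unfolding orbit_span_def
  proof (induction rule: vec.span_induct_alt)
    case base
    show ?case
      by (rule bexI[of _ 0]) (auto simp: commutant_def)
  next
    case (step c x y)
    then obtain A T where A: "A \<in> G" "x = A *v u" and T: "T \<in> commutant" "T *v u = y"
      by (auto simp: linear_orbit_def)
    have "A \<in> commutant"
      using A(1) mult_commute by (simp add: commutant_def)
    with T have "(\<chi> i j. T $ i $ j + c * A $ i $ j) \<in> commutant"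
      by (intro commutant_add_scaled)
    moreover have "(\<chi> i j. T $ i $ j + c * A $ i $ j) *v u = c *s x + y"
      using A T by (simp add: matrix_add_scaled_mult)
    ultimately show ?case by blast
  qed
  with that show thesis by blast
qed

text \<open>On the orbit, \<open>T (A u) = A (T u)\<close> lies in the closure because \<open>A\<close> maps the orbit to itself and
  is continuous; continuity of \<open>T\<close> extends this to the closure.\<close>

lemma commutant_maps_closure_orbit:
  assumes "T \<in> commutant" "T *v u \<in> closure (linear_orbit G u)" "x \<in> closure (linear_orbit G u)"
  shows "T *v x \<in> closure (linear_orbit G u)"
proof -
  let ?K = "closure (linear_orbit G u)"
  have G: "A *v y \<in> ?K" if A: "A \<in> G" and y: "y \<in> ?K" for A y
  proof -
    have "(*v) A ` linear_orbit G u \<subseteq> linear_orbit G u"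
      using A mult_mem by (auto simp: linear_orbit_def matrix_vector_mul_assoc)
    then have "(*v) A ` ?K \<subseteq> ?K"
      using closure_subset
      by (intro image_closure_subset continuous_on_matrix_vector_mult_complex closed_closure) blast
    with y show ?thesis by blast
  qed
  have "(*v) T ` linear_orbit G u \<subseteq> ?K"
    using assms G by (auto simp: linear_orbit_def commutantD)
  then have "(*v) T ` ?K \<subseteq> ?K"
    by (intro image_closure_subset continuous_on_matrix_vector_mult_complex closed_closure)
  with assms show ?thesis by blast
qed

text \<open>The image \<open>N = T V\<close> is a neighbourhood as required. It lies in the closure and hence in the
  span, so \<open>T\<close> is an injective continuous map of \<open>V\<close> into the subspace in which \<open>V\<close> is open, and
  invariance of domain shows that \<open>N\<close> is open in that subspace.\<close>

lemma closure_orbit_neighbourhood: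
  assumes V: "openin (top_of_set (orbit_span G u)) V" "u \<in> V" "V \<subseteq> closure (linear_orbit G u)"
    and T: "T \<in> commutant" "invertible T" and Tu: "T *v u \<in> closure (linear_orbit G u)"
  obtains N where "openin (top_of_set (orbit_span G u)) N" "T *v u \<in> N"
    "N \<subseteq> closure (linear_orbit G u)"
proof
  let ?E = "orbit_span G u"
  have E: "subspace ?E"
    by (simp add: orbit_span_def subspace_if_vec_subspace)
  show TK: "(*v) T ` V \<subseteq> closure (linear_orbit G u)"
    using V(3) commutant_maps_closure_orbit[OF T(1) Tu] by blast
  have TE: "(*v) T ` V \<subseteq> ?E"
    using TK closure_orbit_subset_span by blast
  have "inj ((*v) T)"
    using T(2) by (metis bij_is_inj invertible_eq_bij)
  then have "inj_on ((*v) T) V"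
    by (rule inj_on_subset) simp
  then show "openin (top_of_set ?E) ((*v) T ` V)"
    using TE by (intro invariance_of_domain_subspaces[OF V(1) E E]
        continuous_on_matrix_vector_mult_complex) auto
  show "T *v u \<in> (*v) T ` V"
    using V by blast
qed

text \<open>A connectedness argument on the line of matrices from \<open>1\<close> to a matrix that takes \<open>u\<close> to a given
  vector \<open>w\<close> of the span. The complex line is essential: removing the finitely many singular parameters
  leaves it connected, whereas it could disconnect a real line.\<close>

lemma closure_orbit_eq_span:
  assumes V: "openin (top_of_set (orbit_span G u)) V" "u \<in> V" "V \<subseteq> closure (linear_orbit G u)"
  shows "closure (linear_orbit G u) = orbit_span G u"
proof (intro subset_antisym closure_orbit_subset_span subsetI)
  let ?E = "orbit_span G u" and ?K = "closure (linear_orbit G u)"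
  fix w assume w: "w \<in> ?E"
  obtain T where T: "T \<in> commutant" "T *v u = w"
    using orbit_span_eq_commutant_orbit[OF w] .
  define p where "p c = (\<chi> i j. (mat 1 :: complex ^ 'n ^ 'n) $ i $ j + c * (T - mat 1) $ i $ j)" for c
  have p_mult: "p c *v x = x + c *s (T *v x - x)" for c x
    unfolding p_def matrix_add_scaled_mult by (simp add: matrix_vector_mult_diff_rdistrib)
  have "T - mat 1 \<in> commutant"
    unfolding commutant_def by (auto simp: matrix_eq matrix_vector_mult_diff_rdistrib
        matrix_vector_mult_diff_distrib commutantD[OF T(1)] simp flip: matrix_vector_mul_assoc)
  then have p_commutant: "p c \<in> commutant" for c
    unfolding p_def by (intro commutant_add_scaled) (simp_all add: commutant_def)
  define q where "q c = p c *v u" for c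
  have q_eq: "q c = u + c *s (w - u)" for c
    by (simp add: q_def p_mult T)
  have u: "u \<in> ?E"
    using openin_imp_subset[OF V(1)] V(2) by blast
  have q_E: "q c \<in> ?E" for c
    using u w unfolding q_eq orbit_span_def
    by (intro vec.span_add vec.span_scale vec.span_diff)
  have q_cont: "continuous_on X q" for X
    unfolding q_eq vector_scalar_mult_def by (intro continuous_intros)
  define Z where "Z = - {c. det (p c) = 0}"
  have fin: "finite {c. det (p c) = 0}"
    unfolding p_def by (rule finite_singular_parameters) simp
  then have Z_conn: "connected Z"
    using connected_open_diff_countable[of "UNIV :: complex set" "{c. det (p c) = 0}"]
    by (simp add: Z_def Compl_eq_Diff_UNIV countable_finite connected_UNIV)
  have "0 \<in> Z"
  proof -
    have "p 0 = mat 1" by (simp add: p_def vec_eq_iff)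
    then show ?thesis by (simp add: Z_def)
  qed
  \<comment> \<open>the nonsingular parameters that move \<open>u\<close> within the closure: both closed and open in \<open>Z\<close>\<close>
  define C where "C = {c \<in> Z. q c \<in> ?K}"
  have "closedin (top_of_set Z) C"
    unfolding C_def using continuous_closedin_preimage[OF q_cont closed_closure]
    by (simp add: vimage_def Int_def)
  moreover have "openin (top_of_set Z) C"
  proof (subst openin_subopen, intro ballI)
    fix c assume c: "c \<in> C"
    then have "invertible (p c)"
      by (simp add: C_def Z_def invertible_det_nz)
    then obtain N where N: "openin (top_of_set ?E) N" "q c \<in> N" "N \<subseteq> ?K"
      using closure_orbit_neighbourhood[OF V p_commutant] c unfolding q_def C_def by blast
    have "openin (top_of_set Z) (Z \<inter> q -` N)"
      using q_E by (intro continuous_openin_preimage[OF q_cont _ N(1)]) auto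
    then show "\<exists>D. openin (top_of_set Z) D \<and> c \<in> D \<and> D \<subseteq> C"
      using N c by (intro exI[of _ "Z \<inter> q -` N"]) (auto simp: C_def)
  qed
  moreover have "0 \<in> C"
    using \<open>0 \<in> Z\<close> linear_orbit_self[of u] closure_subset by (auto simp: C_def q_eq)
  ultimately have "C = Z"
    using Z_conn by (auto simp: connected_clopen)
  then have "q ` Z \<subseteq> ?K"
    by (auto simp: C_def)
  then have "q ` closure Z \<subseteq> ?K"
    by (intro image_closure_subset q_cont closed_closure)
  \<comment> \<open>\<open>T\<close> itself may be singular, so \<open>1\<close> need not lie in \<open>Z\<close>, but it is a limit of points of \<open>Z\<close>\<close>
  moreover have "closure Z = UNIV"
    unfolding Z_def closure_complement using fin by (simp add: empty_interior_finite)
  moreover have "q 1 = w"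
    by (simp add: q_eq)
  ultimately show "w \<in> ?K"
    by (metis UNIV_I image_subset_iff)
qed

lemma closure_orbit_subspace_iff:
  "vec.subspace (closure (linear_orbit G u)) \<longleftrightarrow> closure (linear_orbit G u) = orbit_span G u"
proof
  assume "vec.subspace (closure (linear_orbit G u))"
  then show "closure (linear_orbit G u) = orbit_span G u"
    using closure_orbit_subset_span closure_subset
    by (metis orbit_span_def vec.span_minimal subset_antisym)
next
  assume "closure (linear_orbit G u) = orbit_span G u"
  then show "vec.subspace (closure (linear_orbit G u))"
    by (simp add: orbit_span_def)
qed

end

theorem theorem1p5:
  fixes G :: "(complex ^ 'n ^ 'n) set" and u :: "complex ^ 'n"
  assumes "subgroup G general_linear_group"
    and "comm_group (general_linear_group\<lparr>carrier := G\<rparr>)"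
  shows "vec.subspace (closure (linear_orbit G u)) \<longleftrightarrow>
    regular_with_order (linear_orbit G u) (2 * orbit_rank G u)"
proof -
  interpret commuting_matrix_monoid G
  proof
    show "mat 1 \<in> G"
      using subgroup.one_closed[OF assms(1)] by (simp add: general_linear_group_def)
    show "A ** B \<in> G" if "A \<in> G" "B \<in> G" for A B
      using subgroup.m_closed[OF assms(1) that] by (simp add: general_linear_group_def)
    show "A ** B = B ** A" if "A \<in> G" "B \<in> G" for A B
      using comm_groupE(4)[OF assms(2), of A B] that by (simp add: general_linear_group_def)
  qed
  let ?\<gamma> = "linear_orbit G u" and ?E = "orbit_span G u"
  have E: "subspace ?E" and dim_E: "dim ?E = 2 * orbit_rank G u"
    by (simp_all add: orbit_span_def orbit_rank_def subspace_if_vec_subspace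
        dim_eq_twice_vec_dim vec.subspace_span del: vec.dim_span)
  show ?thesis
    unfolding closure_orbit_subspace_iff
  proof
    assume "closure ?\<gamma> = ?E"
    then show "regular_with_order ?\<gamma> (2 * orbit_rank G u)"
      unfolding regular_with_order_def
      using topological_manifold_subspace[OF E]
      by (auto simp: dim_E intro!: exI[of _ UNIV])
  next
    assume "regular_with_order ?\<gamma> (2 * orbit_rank G u)"
    then obtain W where W: "open W" "u \<in> W"
      "topological_manifold (dim ?E) (top_of_set (closure ?\<gamma> \<inter> W))"
      unfolding regular_with_order_def dim_E using linear_orbit_self by blast
    have "u \<in> closure ?\<gamma> \<inter> W"
      using W linear_orbit_self closure_subset by blast
    moreover have "closure ?\<gamma> \<inter> W \<subseteq> ?E"
      using closure_orbit_subset_span by blast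
    ultimately obtain V where "openin (top_of_set ?E) V" "u \<in> V" "V \<subseteq> closure ?\<gamma> \<inter> W"
      using full_dimensional_submanifold_open[OF E _ W(3)] by metis
    then show "closure ?\<gamma> = ?E"
      by (intro closure_orbit_eq_span[of u V]) auto
  qed
qed

end
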